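(* Let $\mathbb{F}$ be a field, and let $\Phi$ be a sharp mock tridiagonal system over $\mathbb{F}$. Then there exists a sharp tridiagonal system over $\mathbb{F}$ that has the same parameter array as $\Phi$.
   Context: Let $\mathbb{F}$ be a field and $V$ a vector space over $\mathbb{F}$ with finite positive dimension. $\mathrm{End}(V)$ denotes the $\mathbb{F}$-algebra of $\mathbb{F}$-linear maps $V\to V$, with identity $I$. An element $A\in\mathrm{End}(V)$ is diagonalizable if $V$ is spanned by the eigenspaces of $A$. If $A$ is diagonalizable and $\{V_i\}_{i=0}^d$ is an ordering of its (nonzero, distinct) eigenspaces, with corresponding eigenvalues $\{\theta_i\}_{i=0}^d$, then the primitive idempotent $E_i$ of $A$ corresponding to $V_i$ (or $\theta_i$) is the element of $\mathrm{End}(V)$ with $(E_i-I)V_i=0$ and $E_iV_j=0$ for $j\ne i$; thus $V_i=E_iV$. The symbol $A^*$ does not denote a conjugate-transpose or adjoint; it is just another element of $\mathrm{End}(V)$, and similarly for $E_i^*$, $\theta_i^*$. Tridiagonal (TD) system on $V$: a sequence $(A;\{E_i\}_{i=0}^d;A^*;\{E^*_i\}_{i=0}^\delta)$ such that (i) $A,A^*\in\mathrm{End}(V)$ are diagonalizable; (ii) $\{E_i\}_{i=0}^d$ is an ordering of the primitive idempotents of $A$ with $E_iA^*E_j=0$ if $|i-j|>1$ ($0\le i,j\le d$); (iii) $\{E^*_i\}_{i=0}^\delta$ is an ordering of the primitive idempotents of $A^*$ with $E^*_iAE^*_j=0$ if $|i-j|>1$ ($0\le i,j\le\delta$); (iv)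 there is no subspace $W$ of $V$ with $AW\subseteq W$, $A^*W\subseteq W$, $W\ne0$, $W\ne V$. It is known that $d=\delta$ for every TD system. Mock tridiagonal (MTD) system on $V$: a sequence $(A;\{E_i\}_{i=0}^d;A^*;\{E^*_i\}_{i=0}^d)$ satisfying (i), (ii), (iii) above with $\delta=d$, and such that each of $E^*_0E_0E^*_0$, $E^*_0E_dE^*_0$ is nonzero. Every TD system is an MTD system. A TD or MTD system is "over $\mathbb{F}$" if it is such a system on some vector space over $\mathbb{F}$ of finite positive dimension (the vector spaces for two different systems need not be the same). For an MTD system (in particular a TD system), $\theta_i$ (resp. $\theta^*_i$) denotes the eigenvalue of $A$ (resp. $A^*$) associated with $E_iV$ (resp. $E^*_iV$); $\{\theta_i\}_{i=0}^d$ is the eigenvalue sequence and $\{\theta^*_i\}_{i=0}^d$ the dual eigenvalue sequence. The system is sharp if $\dim E^*_0V=1$. For a sharp system, with $\tau_i(\lambda)=(\lambda-\theta_0)(\lambda-\theta_1)\cdots(\lambda-\theta_{i-1})$, for each $0\le i\le d$ there is a unique $\zeta_i\in\mathbb{F}$ with $$E^*_0\tau_i(A)E^*_0=\frac{\zeta_iE^*_0}{(\theta^*_0-\theta^*_1)(\theta^*_0-\theta^*_2)\cdots(\theta^*_0-\theta^*_i)};$$ $\{\zeta_i\}_{i=0}^d$ is the split sequence, and the parameter array of the sharp system is $(\{\theta_i\}_{i=0}^d;\{\theta^*_i\}_{i=0}^d;\{\zeta_i\}_{i=0}^d)$. *)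

theory Defs
  imports Main HOL.Vector_Spaces "HOL-Library.Function_Algebras"
begin

text \<open>
  A vector space is a subspace \<open>V\<close> of some ambient \<open>vector_space\<close>; the ambient space itself may be
  infinite-dimensional.  Elements of \<open>End(V)\<close> are represented by functions on the ambient type whose
  values outside \<open>V\<close> are irrelevant, so every condition below is relativised to \<open>V\<close>.  Sequences
  such as \<open>E\<^sub>0, \<dots>, E\<^sub>d\<close> are functions on \<open>nat\<close> of which only the values at \<open>0, \<dots>, d\<close> matter.
  We write \<open>A'\<close>, \<open>E'\<close>, \<open>\<theta>'\<close> for the starred objects \<open>A\<^sup>*\<close>, \<open>E\<^sup>*\<close>, \<open>\<theta>\<^sup>*\<close>.
\<close>

context vector_space
begin

definition fin_pos_dim :: "'b set \<Rightarrow> bool" where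
  "fin_pos_dim V \<longleftrightarrow> subspace V \<and> (\<exists>B. finite B \<and> span B = V) \<and> dim V > 0"

definition endo :: "'b set \<Rightarrow> ('b \<Rightarrow> 'b) \<Rightarrow> bool" where
  "endo V A \<longleftrightarrow> (\<forall>v\<in>V. A v \<in> V)
     \<and> (\<forall>v\<in>V. \<forall>w\<in>V. A (v + w) = A v + A w)
     \<and> (\<forall>c. \<forall>v\<in>V. A (c *s v) = c *s A v)"

definition eigenspace :: "'b set \<Rightarrow> ('b \<Rightarrow> 'b) \<Rightarrow> 'a \<Rightarrow> 'b set" where
  "eigenspace V A \<theta> = {v \<in> V. A v = \<theta> *s v}"

definition eigenvalues :: "'b set \<Rightarrow> ('b \<Rightarrow> 'b) \<Rightarrow> 'a set" where
  "eigenvalues V A = {\<theta>. eigenspace V A \<theta> \<noteq> {0}}"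

definition diagonalizable :: "'b set \<Rightarrow> ('b \<Rightarrow> 'b) \<Rightarrow> bool" where
  "diagonalizable V A \<longleftrightarrow> endo V A \<and> span (\<Union>\<theta>\<in>eigenvalues V A. eigenspace V A \<theta>) = V"

definition primitive_idempotent :: "'b set \<Rightarrow> ('b \<Rightarrow> 'b) \<Rightarrow> 'a \<Rightarrow> ('b \<Rightarrow> 'b) \<Rightarrow> bool" where
  "primitive_idempotent V A \<theta> E \<longleftrightarrow> endo V E \<and> \<theta> \<in> eigenvalues V A
     \<and> (\<forall>v\<in>eigenspace V A \<theta>. E v = v)
     \<and> (\<forall>\<mu>\<in>eigenvalues V A. \<mu> \<noteq> \<theta> \<longrightarrow> (\<forall>v\<in>eigenspace V A \<mu>. E v = 0))"

definition primitive_idempotent_ordering ::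
    "'b set \<Rightarrow> ('b \<Rightarrow> 'b) \<Rightarrow> nat \<Rightarrow> (nat \<Rightarrow> 'b \<Rightarrow> 'b) \<Rightarrow> bool" where
  "primitive_idempotent_ordering V A d E \<longleftrightarrow>
     (\<exists>\<theta>. bij_betw \<theta> {0..d} (eigenvalues V A) \<and>
          (\<forall>i\<in>{0..d}. primitive_idempotent V A (\<theta> i) (E i)))"

definition tridiagonal_action ::
    "'b set \<Rightarrow> nat \<Rightarrow> (nat \<Rightarrow> 'b \<Rightarrow> 'b) \<Rightarrow> ('b \<Rightarrow> 'b) \<Rightarrow> bool" where
  "tridiagonal_action V d E B \<longleftrightarrow>
     (\<forall>i\<in>{0..d}. \<forall>j\<in>{0..d}. \<bar>int i - int j\<bar> > 1 \<longrightarrow> (\<forall>v\<in>V. E i (B (E j v)) = 0))"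

text \<open>
  Common part of the two notions below; the irreducibility of tridiagonal systems and the
  nonvanishing conditions of mock tridiagonal systems are added separately.
\<close>

definition pre_td_system ::
    "'b set \<Rightarrow> nat \<Rightarrow> nat \<Rightarrow> ('b \<Rightarrow> 'b) \<Rightarrow> (nat \<Rightarrow> 'b \<Rightarrow> 'b) \<Rightarrow> ('b \<Rightarrow> 'b) \<Rightarrow> (nat \<Rightarrow> 'b \<Rightarrow> 'b) \<Rightarrow> bool"
  where
  "pre_td_system V d \<delta> A E A' E' \<longleftrightarrow> fin_pos_dim V
     \<and> diagonalizable V A \<and> diagonalizable V A'
     \<and> primitive_idempotent_ordering V A d E \<and> tridiagonal_action V d E A'
     \<and> primitive_idempotent_ordering V A' \<delta> E' \<and> tridiagonal_action V \<delta> E' A"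

definition td_system ::
    "'b set \<Rightarrow> nat \<Rightarrow> nat \<Rightarrow> ('b \<Rightarrow> 'b) \<Rightarrow> (nat \<Rightarrow> 'b \<Rightarrow> 'b) \<Rightarrow> ('b \<Rightarrow> 'b) \<Rightarrow> (nat \<Rightarrow> 'b \<Rightarrow> 'b) \<Rightarrow> bool"
  where
  "td_system V d \<delta> A E A' E' \<longleftrightarrow> pre_td_system V d \<delta> A E A' E'
     \<and> \<not> (\<exists>W. subspace W \<and> W \<subseteq> V \<and> A ` W \<subseteq> W \<and> A' ` W \<subseteq> W \<and> W \<noteq> {0} \<and> W \<noteq> V)"

definition mtd_system ::
    "'b set \<Rightarrow> nat \<Rightarrow> ('b \<Rightarrow> 'b) \<Rightarrow> (nat \<Rightarrow> 'b \<Rightarrow> 'b) \<Rightarrow> ('b \<Rightarrow> 'b) \<Rightarrow> (nat \<Rightarrow> 'b \<Rightarrow> 'b) \<Rightarrow> bool"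
  where
  "mtd_system V d A E A' E' \<longleftrightarrow> pre_td_system V d d A E A' E'
     \<and> (\<exists>v\<in>V. E' 0 (E 0 (E' 0 v)) \<noteq> 0)
     \<and> (\<exists>v\<in>V. E' 0 (E d (E' 0 v)) \<noteq> 0)"

definition sharp :: "'b set \<Rightarrow> (nat \<Rightarrow> 'b \<Rightarrow> 'b) \<Rightarrow> bool" where
  "sharp V E' \<longleftrightarrow> dim (E' 0 ` V) = 1"

definition eigenvalue_seq :: "'b set \<Rightarrow> ('b \<Rightarrow> 'b) \<Rightarrow> (nat \<Rightarrow> 'b \<Rightarrow> 'b) \<Rightarrow> nat \<Rightarrow> 'a" where
  "eigenvalue_seq V A E i = (THE \<theta>. eigenspace V A \<theta> = E i ` V)"

text \<open>\<open>tau A \<theta> i\<close> is the operator \<open>\<tau>\<^sub>i(A) = (A - \<theta>\<^sub>0 I) \<cdots> (A - \<theta>\<^sub>i\<^sub>-\<^sub>1 I)\<close>.\<close>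

primrec tau :: "('b \<Rightarrow> 'b) \<Rightarrow> (nat \<Rightarrow> 'a) \<Rightarrow> nat \<Rightarrow> 'b \<Rightarrow> 'b" where
  "tau A \<theta> 0 = (\<lambda>v. v)"
| "tau A \<theta> (Suc i) = (\<lambda>v. A (tau A \<theta> i v) - \<theta> i *s tau A \<theta> i v)"

definition split_seq ::
    "'b set \<Rightarrow> ('b \<Rightarrow> 'b) \<Rightarrow> (nat \<Rightarrow> 'b \<Rightarrow> 'b) \<Rightarrow> ('b \<Rightarrow> 'b) \<Rightarrow> (nat \<Rightarrow> 'b \<Rightarrow> 'b) \<Rightarrow> nat \<Rightarrow> 'a" where
  "split_seq V A E A' E' i =
     (let \<theta> = eigenvalue_seq V A E; \<theta>' = eigenvalue_seq V A' E'
      in THE \<zeta>. \<forall>v\<in>V. E' 0 (tau A \<theta> i (E' 0 v)) = (\<zeta> / (\<Prod>j=1..i. \<theta>' 0 - \<theta>' j)) *s E' 0 v)"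

text \<open>
  The three sequences are lists, so that equality of parameter arrays includes equality of the
  diameters.
\<close>

definition parameter_array ::
    "'b set \<Rightarrow> nat \<Rightarrow> nat \<Rightarrow> ('b \<Rightarrow> 'b) \<Rightarrow> (nat \<Rightarrow> 'b \<Rightarrow> 'b) \<Rightarrow> ('b \<Rightarrow> 'b) \<Rightarrow> (nat \<Rightarrow> 'b \<Rightarrow> 'b)
      \<Rightarrow> 'a list \<times> 'a list \<times> 'a list" where
  "parameter_array V d \<delta> A E A' E' =
     (map (eigenvalue_seq V A E) [0..<Suc d],
      map (eigenvalue_seq V A' E') [0..<Suc \<delta>],
      map (split_seq V A E A' E') [0..<Suc d])"

end

text \<open>
  The pointwise vector space of all sequences over the field.  Every finite-dimensional
  vector space over the field is isomorphic to a subspace of it, so existence of a system on some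
  vector space is existence of one on a subspace of this space.
\<close>

definition seq_scale :: "'f::field \<Rightarrow> (nat \<Rightarrow> 'f) \<Rightarrow> nat \<Rightarrow> 'f" where
  "seq_scale c x = (\<lambda>n. c * x n)"

lemma vector_space_seq_scale: "vector_space seq_scale"
  by unfold_locales (simp_all add: seq_scale_def plus_fun_def algebra_simps)

end

theory Submission
  imports Defs "HOL-Library.Countable"
begin

text \<open>
  Write \<open>E' 0 ` V = span {v0}\<close>.  The tridiagonal system is the irreducible subquotient of \<open>V\<close>
  that carries the line of \<open>v0\<close>: let \<open>M\<close> be the smallest subspace that contains \<open>v0\<close> and is
  invariant under \<open>A\<close> and \<open>A'\<close>, and divide \<open>M\<close> by its largest invariant subspace on which \<open>E' 0\<close>
  vanishes.  An invariant subspace \<open>X\<close> of \<open>M\<close> is stable under \<open>E' 0\<close>, because \<open>E' 0\<close> is a spectral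
  projection of \<open>A'\<close>.  Hence either \<open>E' 0\<close> vanishes on \<open>X\<close>, or \<open>v0 \<in> X\<close> and \<open>X = M\<close>; so the quotient
  is irreducible.  The scalars by which the operators \<open>E' 0 \<tau>\<^sub>i(A) E' 0\<close> act on the line of \<open>v0\<close>
  survive in the quotient, which gives the same split sequence, provided that the eigenvalue
  sequences are unchanged, that is, provided that no \<open>E i\<close> and no \<open>E' i\<close> becomes zero.

  This is the main point, and it is a statement about irreducible pairs whose idempotents may be zero
  (\<open>irreducible_idempotents_nonzero\<close>): if \<open>E 0\<close>, \<open>E d\<close> and \<open>E' 0\<close> are nonzero, then so are
  all the others.  The conditions \<open>E' 0 E 0 E' 0 \<noteq> 0\<close> and \<open>E' 0 E d E' 0 \<noteq> 0\<close> say that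
  \<open>E 0 v0\<close> and \<open>E d v0\<close> have nonzero projections to the line of \<open>v0\<close>, so \<open>E 0\<close> and \<open>E d\<close> are
  nonzero on the quotient.  A zero idempotent in the middle would split the space, by
  tridiagonality (\<open>idempotents_vanish_beyond_gap\<close>).  That \<open>E' d\<close> is not zero is a form of the
  theorem that the two diameters of a tridiagonal system agree
  (\<open>dual_last_idempotent_nonzero\<close>).

  The quotient is realised inside the space of sequences.  Send \<open>x\<close> to the sequence of
  \<open>v0\<close>-coordinates of \<open>E' 0 (w x)\<close>, where \<open>w\<close> runs through an enumeration of all words in \<open>A\<close> and
  \<open>A'\<close>.  The kernel of this map is the largest invariant subspace on which \<open>E' 0\<close> vanishes, so the
  image of \<open>M\<close> is the quotient, and \<open>A\<close> and \<open>A'\<close> become two shifts of sequences.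
\<close>

section \<open>Endomorphisms of a subspace\<close>

context vector_space
begin

lemma endo_closed: "endo V A \<Longrightarrow> v \<in> V \<Longrightarrow> A v \<in> V"
  and endo_add: "endo V A \<Longrightarrow> v \<in> V \<Longrightarrow> w \<in> V \<Longrightarrow> A (v + w) = A v + A w"
  and endo_scale: "endo V A \<Longrightarrow> v \<in> V \<Longrightarrow> A (c *s v) = c *s A v"
  by (auto simp: endo_def)

lemma endo_0: "subspace V \<Longrightarrow> endo V A \<Longrightarrow> A 0 = 0"
  using endo_scale[of V A 0 0] subspace_0 by simp

lemma endo_diff:
  assumes "subspace V" "endo V A" "v \<in> V" "w \<in> V"
  shows "A (v - w) = A v - A w"
  using endo_add[OF assms(2), of "v - w" w] assms subspace_diff[of V v w] by (simp add: algebra_simps)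

lemma endo_sum:
  assumes "subspace V" "endo V A" "\<And>i. i \<in> S \<Longrightarrow> u i \<in> V"
  shows "A (\<Sum>i\<in>S. u i) = (\<Sum>i\<in>S. A (u i))"
  using assms(3)
proof (induction S rule: infinite_finite_induct)
  case (insert i S)
  then show ?case
    using endo_add[OF assms(2), of "u i" "sum u S"] subspace_sum[OF assms(1), of S u] by simp
qed (simp_all add: endo_0[OF assms(1,2)])

lemma subspace_preimage:
  assumes "subspace V" "endo V A" "subspace X"
  shows "subspace {v \<in> V. A v \<in> X}"
  unfolding subspace_def
  using assms endo_0[OF assms(1,2)]
  by (auto simp: endo_add endo_scale subspace_0 subspace_add subspace_scale)

lemma subspace_kernel:
  assumes "subspace V" "endo V A"
  shows "subspace {v \<in> V. A v = 0}"
  using subspace_preimage[OF assms subspace_single_0] by simp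

lemma endo_image_span_subset:
  assumes "subspace V" "endo V A" "G \<subseteq> V" "subspace X" "A ` G \<subseteq> X"
  shows "A ` span G \<subseteq> X"
proof -
  have "span G \<subseteq> {v \<in> V. A v \<in> X}"
    using assms by (intro span_minimal subspace_preimage) auto
  then show ?thesis by blast
qed

lemma dim_line: "v \<noteq> 0 \<Longrightarrow> dim (span {v}) = 1"
  using dim_span_eq_card_independent[of "{v}"] by (simp add: dependent_single)

text \<open>
  An invariant subspace contains, with a sum of eigenvectors for distinct eigenvalues, each of
  the summands: applying \<open>A - \<theta> j\<close> removes the summand \<open>j\<close> and multiplies the others by nonzero
  scalars, so induction on the number of summands applies.  With \<open>X = {0}\<close> this is the linear
  independence of eigenvectors.
\<close>

lemma eigenvector_components_mem:
  assumes "subspace V" "endo V A" "subspace X" "X \<subseteq> V" "A ` X \<subseteq> X"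
    and "finite S" "inj_on \<theta> S"
    and "\<And>i. i \<in> S \<Longrightarrow> u i \<in> V" "\<And>i. i \<in> S \<Longrightarrow> A (u i) = \<theta> i *s u i"
    and "(\<Sum>i\<in>S. u i) \<in> X" "k \<in> S"
  shows "u k \<in> X"
  using assms(6-)
proof (induction S arbitrary: u k rule: finite_induct)
  case (insert j S)
  define x where "x = (\<Sum>i\<in>insert j S. u i)"
  have x: "x \<in> X" using insert.prems by (simp add: x_def)
  have "A x - \<theta> j *s x = (\<Sum>i\<in>insert j S. A (u i)) - (\<Sum>i\<in>insert j S. \<theta> j *s u i)"
    unfolding x_def using insert.prems(2)
    by (subst endo_sum[OF assms(1,2)]) (auto simp: scale_sum_right)
  also have "\<dots> = (\<Sum>i\<in>insert j S. (\<theta> i - \<theta> j) *s u i)"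
    unfolding sum_subtractf[symmetric]
    by (intro sum.cong refl) (simp add: insert.prems(3) scale_left_diff_distrib)
  also have "\<dots> = (\<Sum>i\<in>S. (\<theta> i - \<theta> j) *s u i)"
    using insert.hyps by simp
  finally have eq: "(\<Sum>i\<in>S. (\<theta> i - \<theta> j) *s u i) = A x - \<theta> j *s x" by simp
  \<comment> \<open>the induction hypothesis for the summands rescaled by \<open>A - \<theta> j\<close>\<close>
  have *: "(\<theta> i - \<theta> j) *s u i \<in> X" if "i \<in> S" for i
  proof (rule insert.IH[of "\<lambda>i. (\<theta> i - \<theta> j) *s u i"])
    show "(\<Sum>i\<in>S. (\<theta> i - \<theta> j) *s u i) \<in> X"
      unfolding eq using x assms(3,5) by (auto intro!: subspace_diff subspace_scale)
  next
    fix i assume "i \<in> S"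
    then show "A ((\<theta> i - \<theta> j) *s u i) = \<theta> i *s (\<theta> i - \<theta> j) *s u i"
      using insert.prems by (simp add: endo_scale[OF assms(2)] mult.commute)
  qed (use that insert.prems assms(1) in \<open>auto intro: subspace_scale\<close>)
  have S: "u i \<in> X" if "i \<in> S" for i
  proof -
    have "\<theta> i \<noteq> \<theta> j" using insert.prems(1) insert.hyps that by (auto simp: inj_on_def)
    then have "inverse (\<theta> i - \<theta> j) *s ((\<theta> i - \<theta> j) *s u i) = u i" by simp
    then show ?thesis using subspace_scale[OF assms(3) *[OF that]] by metis
  qed
  have "u j = x - (\<Sum>i\<in>S. u i)" using insert.hyps by (simp add: x_def)
  then have "u j \<in> X" using x S assms(3) by (auto intro!: subspace_diff subspace_sum)
  then show ?case using S insert.prems by auto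
qed simp

section \<open>Spectral resolutions\<close>

text \<open>
  The list of primitive idempotents of a diagonalizable \<open>A\<close>, except that some \<open>E i\<close> may be zero, in
  which case \<open>\<theta> i\<close> is not an eigenvalue.  Unlike an ordering of primitive idempotents, this
  structure passes to every invariant subquotient.
\<close>

definition spectral_resolution ::
    "'b set \<Rightarrow> nat \<Rightarrow> ('b \<Rightarrow> 'b) \<Rightarrow> (nat \<Rightarrow> 'a) \<Rightarrow> (nat \<Rightarrow> 'b \<Rightarrow> 'b) \<Rightarrow> bool" where
  "spectral_resolution V d A \<theta> E \<longleftrightarrow> subspace V \<and> endo V A \<and> inj_on \<theta> {..d}
     \<and> (\<forall>i\<le>d. endo V (E i) \<and> (\<forall>v\<in>V. A (E i v) = \<theta> i *s E i v))
     \<and> (\<forall>v\<in>V. (\<Sum>i\<le>d. E i v) = v)"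

lemma spectral_resolutionD:
  assumes "spectral_resolution V d A \<theta> E"
  shows "subspace V" "endo V A" "inj_on \<theta> {..d}"
    and "i \<le> d \<Longrightarrow> endo V (E i)"
    and "i \<le> d \<Longrightarrow> v \<in> V \<Longrightarrow> A (E i v) = \<theta> i *s E i v"
    and "v \<in> V \<Longrightarrow> (\<Sum>i\<le>d. E i v) = v"
  using assms by (auto simp: spectral_resolution_def)

lemma spectral_resolution_mem:
  "spectral_resolution V d A \<theta> E \<Longrightarrow> i \<le> d \<Longrightarrow> v \<in> V \<Longrightarrow> E i v \<in> V"
  using spectral_resolutionD(4) endo_closed by blast

text \<open>
  This replaces the usual argument that \<open>E i\<close> is a polynomial in \<open>A\<close>.
\<close>

lemma spectral_resolution_invariant:
  assumes "spectral_resolution V d A \<theta> E" "subspace X" "X \<subseteq> V" "A ` X \<subseteq> X" "x \<in> X" "i \<le> d"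
  shows "E i x \<in> X"
proof (rule eigenvector_components_mem[where u = "\<lambda>i. E i x" and S = "{..d}" and k = i])
  note D = spectral_resolutionD[OF assms(1)]
  have xV: "x \<in> V" using assms by auto
  show "(\<Sum>i\<le>d. E i x) \<in> X" using D(6)[OF xV] assms by simp
  show "\<And>i. i \<in> {..d} \<Longrightarrow> E i x \<in> V" using D(4) xV by (auto intro: endo_closed)
  show "\<And>i. i \<in> {..d} \<Longrightarrow> A (E i x) = \<theta> i *s E i x" using D(5) xV by auto
qed (use assms spectral_resolutionD[OF assms(1)] in auto)

lemma spectral_resolution_eigenvector:
  assumes "spectral_resolution V d A \<theta> E" "u \<in> V" "A u = \<theta> j *s u" "j \<le> d" "i \<le> d"
  shows "E i u = (if i = j then u else 0)"
proof -
  note D = spectral_resolutionD[OF assms(1)]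
  define w where "w k = E k u - (if k = j then u else 0)" for k
  have "w i \<in> {0}"
  proof (rule eigenvector_components_mem[OF D(1,2), where S = "{..d}" and \<theta> = \<theta>])
    show "(\<Sum>k\<le>d. w k) \<in> {0}"
      using D(6)[OF assms(2)] assms(4) by (simp add: w_def sum_subtractf)
    fix k assume "k \<in> {..d}"
    then have Ek: "E k u \<in> V" "A (E k u) = \<theta> k *s E k u"
      using spectral_resolution_mem[OF assms(1)] D(5) assms(2) by auto
    then show "w k \<in> V" "A (w k) = \<theta> k *s w k"
      using endo_diff[OF D(1,2) Ek(1) assms(2)] assms(2,3) subspace_diff[OF D(1)]
      by (auto simp: w_def scale_right_diff_distrib)
  qed (use D(1,3) assms(4,5) endo_0[OF D(1,2)] in \<open>auto simp: subspace_0\<close>)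
  then show ?thesis by (auto simp: w_def split: if_splits)
qed

lemma spectral_resolution_orthogonal:
  assumes "spectral_resolution V d A \<theta> E" "v \<in> V" "j \<le> d" "i \<le> d"
  shows "E i (E j v) = (if i = j then E j v else 0)"
  using spectral_resolution_eigenvector[OF assms(1) spectral_resolution_mem[OF assms(1,3,2)]
      spectral_resolutionD(5)[OF assms(1,3,2)] assms(3,4)] .

lemma spectral_resolution_commute:
  assumes "spectral_resolution V d A \<theta> E" "v \<in> V" "i \<le> d"
  shows "E i (A v) = \<theta> i *s E i v"
proof -
  note D = spectral_resolutionD[OF assms(1)]
  have Ev: "\<And>j. j \<le> d \<Longrightarrow> E j v \<in> V" using spectral_resolution_mem[OF assms(1)] assms(2) by blast
  have "A v = A (\<Sum>j\<le>d. E j v)" using D(6) assms(2) by simp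
  also have "\<dots> = (\<Sum>j\<le>d. \<theta> j *s E j v)"
    using Ev D(5) assms(2) by (subst endo_sum[OF D(1,2)]) auto
  also have "E i \<dots> = (\<Sum>j\<le>d. E i (\<theta> j *s E j v))"
    using Ev D(1) by (intro endo_sum[OF D(1) D(4)[OF assms(3)]]) (auto intro: subspace_scale)
  finally have "E i (A v) = (\<Sum>j\<le>d. E i (\<theta> j *s E j v))" .
  also have "\<dots> = (\<Sum>j\<le>d. if j = i then \<theta> i *s E i v else 0)"
  proof (rule sum.cong)
    fix j assume "j \<in> {..d}"
    then show "E i (\<theta> j *s E j v) = (if j = i then \<theta> i *s E i v else 0)"
      using endo_scale[OF D(4)[OF assms(3)] Ev, of j]
        spectral_resolution_orthogonal[OF assms(1,2) _ assms(3), of j] by auto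
  qed simp
  finally show ?thesis using assms(3) by simp
qed

lemma spectral_resolution_image:
  assumes "spectral_resolution V d A \<theta> E" "i \<le> d"
  shows "E i ` V = eigenspace V A (\<theta> i)"
proof safe
  fix v assume "v \<in> V"
  then show "E i v \<in> eigenspace V A (\<theta> i)"
    using spectral_resolution_mem[OF assms] spectral_resolutionD(5)[OF assms]
    by (simp add: eigenspace_def)
next
  fix u assume "u \<in> eigenspace V A (\<theta> i)"
  then have "u \<in> V" "E i u = u"
    using spectral_resolution_eigenvector[OF assms(1) _ _ assms(2,2), of u]
    by (auto simp: eigenspace_def)
  then show "u \<in> E i ` V" by (metis imageI)
qed

lemma eigenspace_inject:
  assumes "eigenspace V A \<mu> = eigenspace V A \<nu>" "v \<in> eigenspace V A \<nu>" "v \<noteq> 0"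
  shows "\<mu> = \<nu>"
proof -
  have "v \<in> eigenspace V A \<mu>" "v \<in> eigenspace V A \<nu>" using assms(1,2) by simp_all
  then have "A v = \<mu> *s v" "A v = \<nu> *s v" by (simp_all add: eigenspace_def)
  then show ?thesis using assms(3) scale_right_imp_eq by metis
qed

lemma eigenvalue_seq_spectral:
  assumes "spectral_resolution V d A \<theta> E" "i \<le> d" "v \<in> V" "E i v \<noteq> 0"
  shows "eigenvalue_seq V A E i = \<theta> i"
  unfolding eigenvalue_seq_def spectral_resolution_image[OF assms(1,2)]
proof (rule the_equality)
  fix \<mu> assume "eigenspace V A \<mu> = eigenspace V A (\<theta> i)"
  moreover have "E i v \<in> eigenspace V A (\<theta> i)"
    using spectral_resolution_image[OF assms(1,2)] assms(3) by blast
  ultimately show "\<mu> = \<theta> i" using assms(4) eigenspace_inject by blast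
qed simp

lemma mem_eigenvalues_iff:
  assumes "subspace V" "endo V A"
  shows "\<mu> \<in> eigenvalues V A \<longleftrightarrow> (\<exists>v\<in>V. v \<noteq> 0 \<and> A v = \<mu> *s v)"
proof -
  have "0 \<in> eigenspace V A \<mu>"
    using endo_0[OF assms] subspace_0[OF assms(1)] by (simp add: eigenspace_def)
  then have "eigenspace V A \<mu> \<noteq> {0} \<longleftrightarrow> (\<exists>v\<in>eigenspace V A \<mu>. v \<noteq> 0)" by blast
  then show ?thesis by (auto simp: eigenvalues_def eigenspace_def)
qed

text \<open>
  The set of vectors on which the identities of a spectral resolution hold is a subspace that
  contains all eigenvectors.
\<close>

lemma spectral_resolution_of_ordering:
  assumes V: "subspace V" and dg: "diagonalizable V A" and ord: "primitive_idempotent_ordering V A d E"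
  shows "spectral_resolution V d A (eigenvalue_seq V A E) E" and "\<forall>i\<le>d. \<exists>v\<in>V. E i v \<noteq> 0"
proof -
  have A: "endo V A" and sp: "span (\<Union>\<mu>\<in>eigenvalues V A. eigenspace V A \<mu>) = V"
    using dg by (auto simp: diagonalizable_def)
  obtain \<theta> where bij: "bij_betw \<theta> {0..d} (eigenvalues V A)"
    and pe: "\<And>i. i \<le> d \<Longrightarrow> primitive_idempotent V A (\<theta> i) (E i)"
    using ord by (auto simp: primitive_idempotent_ordering_def)
  have E: "endo V (E i)" if "i \<le> d" for i using pe[OF that] by (simp add: primitive_idempotent_def)
  have inj: "inj_on \<theta> {..d}" using bij by (simp add: bij_betw_def atLeast0AtMost)
  have key: "E i u = (if i = j then u else 0)" if "u \<in> eigenspace V A (\<theta> j)" "i \<le> d" "j \<le> d" for u i j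
  proof -
    have "\<theta> j \<in> eigenvalues V A" using bij that by (auto simp: bij_betw_def)
    moreover have "\<theta> i = \<theta> j \<longleftrightarrow> i = j" using inj that by (auto simp: inj_on_def)
    ultimately show ?thesis using pe[OF that(2)] that(1) by (auto simp: primitive_idempotent_def)
  qed
  define P where "P = {v\<in>V. (\<forall>i\<le>d. A (E i v) = \<theta> i *s E i v) \<and> (\<Sum>i\<le>d. E i v) = v}"
  have "subspace P"
    unfolding subspace_def P_def
    using V A E endo_0[OF V A] endo_0[OF V E] endo_closed[OF E]
    by (auto simp: subspace_0 subspace_add subspace_scale endo_add[OF E] endo_add[OF A] endo_scale[OF E]
        endo_scale[OF A] scale_right_distrib sum.distrib scale_sum_right[symmetric] mult.commute)
  moreover have "(\<Union>\<mu>\<in>eigenvalues V A. eigenspace V A \<mu>) \<subseteq> P"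
  proof safe
    fix \<mu> u assume "\<mu> \<in> eigenvalues V A" and u: "u \<in> eigenspace V A \<mu>"
    then obtain j where j: "j \<le> d" "\<mu> = \<theta> j"
      using bij by (force simp: bij_betw_def)
    have k: "E i u = (if i = j then u else 0)" if "i \<le> d" for i using key u j that by simp
    then have "(\<Sum>i\<le>d. E i u) = (\<Sum>i\<le>d. if i = j then u else 0)" by (intro sum.cong) auto
    then show "u \<in> P" using k u j endo_0[OF V A] by (auto simp: P_def eigenspace_def)
  qed
  ultimately have "V \<subseteq> P" using span_minimal sp by metis
  then have sr: "spectral_resolution V d A \<theta> E"
    using V A E inj by (auto simp: spectral_resolution_def P_def)
  show nz: "\<forall>i\<le>d. \<exists>v\<in>V. E i v \<noteq> 0"
  proof safe
    fix i assume i: "i \<le> d"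
    then have "\<theta> i \<in> eigenvalues V A" using bij by (auto simp: bij_betw_def)
    then obtain v where "v \<in> V" "v \<noteq> 0" "A v = \<theta> i *s v"
      using mem_eigenvalues_iff[OF V A] by auto
    then show "\<exists>v\<in>V. E i v \<noteq> 0" using key[of v i i] i by (intro bexI[of _ v]) (auto simp: eigenspace_def)
  qed
  have "eigenvalue_seq V A E i = \<theta> i" if "i \<le> d" for i
    using eigenvalue_seq_spectral[OF sr that] nz that by blast
  then show "spectral_resolution V d A (eigenvalue_seq V A E) E"
    using sr by (simp add: spectral_resolution_def inj_on_def)
qed

lemma ordering_of_spectral_resolution:
  assumes sr: "spectral_resolution V d A \<theta> E" and nz: "\<forall>i\<le>d. \<exists>v\<in>V. E i v \<noteq> 0"
  shows "diagonalizable V A" and "primitive_idempotent_ordering V A d E"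
proof -
  note D = spectral_resolutionD[OF sr]
  have ev: "\<theta> i \<in> eigenvalues V A" if "i \<le> d" for i
    using nz that spectral_resolution_mem[OF sr] D(5) unfolding mem_eigenvalues_iff[OF D(1,2)] by blast
  have ev': "\<exists>i\<le>d. \<mu> = \<theta> i" if \<mu>: "\<mu> \<in> eigenvalues V A" for \<mu>
  proof -
    obtain v where v: "v \<in> V" "v \<noteq> 0" "A v = \<mu> *s v"
      using \<mu> by (auto simp: mem_eigenvalues_iff[OF D(1,2)])
    have "(\<Sum>i\<le>d. E i v) \<noteq> 0" using D(6) v by simp
    then obtain i where i: "i \<le> d" "E i v \<noteq> 0" by (meson atMost_iff sum.neutral)
    have "\<theta> i *s E i v = \<mu> *s E i v"
      using spectral_resolution_commute[OF sr v(1) i(1)] endo_scale[OF D(4)[OF i(1)] v(1)] v(3) by metis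
    then show ?thesis using i scale_right_imp_eq by metis
  qed
  have bij: "bij_betw \<theta> {0..d} (eigenvalues V A)"
    using D(3) ev ev' by (auto simp: bij_betw_def atLeast0AtMost)
  have pe: "primitive_idempotent V A (\<theta> i) (E i)" if i: "i \<le> d" for i
    unfolding primitive_idempotent_def
  proof (intro conjI ballI impI)
    fix \<mu> v assume "\<mu> \<in> eigenvalues V A" and \<mu>: "\<mu> \<noteq> \<theta> i" "v \<in> eigenspace V A \<mu>"
    then obtain j where "j \<le> d" "\<mu> = \<theta> j" using ev' by blast
    then show "E i v = 0"
      using \<mu> spectral_resolution_eigenvector[OF sr, of v j i] i by (auto simp: eigenspace_def)
  qed (use spectral_resolution_eigenvector[OF sr _ _ i i] ev[OF i] D(4)[OF i] in
      \<open>auto simp: eigenspace_def\<close>)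
  show "primitive_idempotent_ordering V A d E"
    unfolding primitive_idempotent_ordering_def using bij pe by auto
  let ?S = "\<Union>\<mu>\<in>eigenvalues V A. eigenspace V A \<mu>"
  have "v \<in> span ?S" if v: "v \<in> V" for v
  proof -
    have "E i v \<in> span ?S" if "i \<le> d" for i
      using spectral_resolution_image[OF sr that] ev[OF that] v by (intro span_base) blast
    then have "(\<Sum>i\<le>d. E i v) \<in> span ?S" by (auto intro: span_sum)
    then show ?thesis using D(6)[OF v] by simp
  qed
  moreover have "span ?S \<subseteq> V" using D(1) by (intro span_minimal) (auto simp: eigenspace_def)
  ultimately show "diagonalizable V A" using D(2) by (auto simp: diagonalizable_def)
qed

section \<open>Irreducible pairs of spectral resolutions\<close>

text \<open>
  Tridiagonality in the form in which it is used below: the \<open>i\<close>-th component of \<open>B v\<close> depends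
  only on the components of \<open>v\<close> at distance at most one from \<open>i\<close>.
\<close>

lemma tridiagonal_action_eq_0:
  assumes sr: "spectral_resolution V d A \<theta> E" and "endo V B" and tri: "tridiagonal_action V d E B"
    and v: "v \<in> V" and i: "i \<le> d"
    and far: "\<And>j. j \<le> d \<Longrightarrow> \<bar>int i - int j\<bar> \<le> 1 \<Longrightarrow> E j v = 0"
  shows "E i (B v) = 0"
proof -
  note D = spectral_resolutionD[OF sr]
  have Ev: "\<And>j. j \<le> d \<Longrightarrow> E j v \<in> V" using spectral_resolution_mem[OF sr] v by blast
  have "E i (B v) = E i (B (\<Sum>j\<le>d. E j v))" using D(6) v by simp
  also have "\<dots> = (\<Sum>j\<le>d. E i (B (E j v)))"
    using endo_sum[OF D(1) assms(2), of "{..d}" "\<lambda>j. E j v"] Ev endo_closed[OF assms(2)]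
      endo_sum[OF D(1) D(4)[OF i], of "{..d}" "\<lambda>j. B (E j v)"] by simp
  also have "\<dots> = 0"
  proof (rule sum.neutral, safe)
    fix j assume j: "j \<le> d"
    show "E i (B (E j v)) = 0"
    proof (cases "\<bar>int i - int j\<bar> \<le> 1")
      case True
      then show ?thesis
        using far j endo_0[OF D(1) assms(2)] endo_0[OF D(1) D(4)[OF i]] by simp
    next
      case False
      then show ?thesis using tri i j v by (auto simp: tridiagonal_action_def)
    qed
  qed
  finally show ?thesis .
qed

definition irreducible_on :: "'b set \<Rightarrow> ('b \<Rightarrow> 'b) \<Rightarrow> ('b \<Rightarrow> 'b) \<Rightarrow> bool" where
  "irreducible_on V A B \<longleftrightarrow>
     (\<forall>X. subspace X \<and> X \<subseteq> V \<and> A ` X \<subseteq> X \<and> B ` X \<subseteq> X \<longrightarrow> X = {0} \<or> X = V)"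

text \<open>
  If \<open>E k = 0\<close>, then \<open>B\<close> cannot lead from the components below \<open>k\<close> to those above \<open>k\<close>, so the sum
  of the components below \<open>k\<close> is invariant.  It contains \<open>E 0 v0\<close> and is therefore everything.
\<close>

lemma idempotents_vanish_beyond_gap:
  assumes sr: "spectral_resolution V d A \<theta> E" and B: "endo V B" and tri: "tridiagonal_action V d E B"
    and irr: "irreducible_on V A B"
    and E0: "v0 \<in> V" "E 0 v0 \<noteq> 0"
    and k: "k \<le> d" "\<forall>v\<in>V. E k v = 0"
    and v: "v \<in> V" and i: "k \<le> i" "i \<le> d"
  shows "E i v = 0"
proof -
  note D = spectral_resolutionD[OF sr]
  define X where "X = {v \<in> V. \<forall>i. k \<le> i \<and> i \<le> d \<longrightarrow> E i v = 0}"
  have "subspace X"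
    unfolding X_def subspace_def using D(1) D(4) endo_0[OF D(1) D(4)]
    by (auto simp: subspace_0 subspace_add subspace_scale endo_add[OF D(4)] endo_scale[OF D(4)])
  moreover have "A ` X \<subseteq> X"
    using D(2) by (auto simp: X_def endo_closed spectral_resolution_commute[OF sr])
  moreover have "B ` X \<subseteq> X"
  proof -
    have "E i (B x) = 0" if x: "x \<in> X" and i: "k \<le> i" "i \<le> d" for x i
    proof (cases "i = k")
      case True
      then show ?thesis using k x B by (auto simp: X_def intro: endo_closed)
    next
      case False
      then show ?thesis using x i
        by (intro tridiagonal_action_eq_0[OF sr B tri]) (auto simp: X_def)
    qed
    then show ?thesis using B by (auto simp: X_def endo_closed)
  qed
  ultimately have "X = {0} \<or> X = V" using irr by (auto simp: irreducible_on_def X_def)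
  moreover have "0 < k" using k E0 by (metis gr0I)
  then have "E 0 v0 \<in> X"
    using D(4) E0 by (auto simp: X_def spectral_resolution_orthogonal[OF sr] intro: endo_closed)
  ultimately have "X = V" using E0 by auto
  then show ?thesis using v i by (auto simp: X_def)
qed

text \<open>
  The idea is that of the split decomposition.  Let \<open>U i\<close> be the intersection of
  \<open>E' 0 V + \<dots> + E' i V\<close> with \<open>E (i + 1) V + \<dots> + E d V\<close>.  Then \<open>A - \<theta> (i + 1)\<close> maps \<open>U i\<close> into
  \<open>U (i + 1)\<close>: it removes the lowest component with respect to \<open>A\<close> and, by tridiagonality, adds
  at most one component with respect to \<open>A'\<close>.  Likewise \<open>A' - \<theta>' i\<close> maps \<open>U i\<close> into
  \<open>U (i - 1)\<close>, and \<open>U 0\<close> to \<open>0\<close>.  So the sum of all \<open>U i\<close> is invariant.  If \<open>E' d\<close> were zero, then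
  \<open>E' 0 V + \<dots> + E' (d - 1) V\<close> would be all of \<open>V\<close>, and \<open>U (d - 1)\<close> would contain the nonzero space
  \<open>E d V\<close>.  But \<open>E 0\<close> vanishes on every \<open>U i\<close>, so the sum is a proper subspace, which contradicts
  irreducibility.
\<close>

lemma dual_last_idempotent_nonzero:
  assumes sr: "spectral_resolution V d A \<theta> E" and sr': "spectral_resolution V d A' \<theta>' E'"
    and tri: "tridiagonal_action V d E A'" and tri': "tridiagonal_action V d E' A"
    and irr: "irreducible_on V A A'"
    and nz0: "\<exists>v\<in>V. E 0 v \<noteq> 0" and nzd: "\<exists>v\<in>V. E d v \<noteq> 0" and d: "0 < d"
  shows "\<exists>v\<in>V. E' d v \<noteq> 0"
proof (rule ccontr)
  note D = spectral_resolutionD[OF sr]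
  note D' = spectral_resolutionD[OF sr']
  assume "\<not> ?thesis"
  then have E'd: "\<And>v. v \<in> V \<Longrightarrow> E' d v = 0" by auto
  define U where "U i = {v \<in> V. (\<forall>j\<le>d. i < j \<longrightarrow> E' j v = 0) \<and> (\<forall>j\<le>d. j \<le> i \<longrightarrow> E j v = 0)}" for i
  define X where "X = span (\<Union>i. U i)"
  have UV: "x \<in> V" if "x \<in> U i" for x i using that by (simp add: U_def)
  have UX: "x \<in> X" if "x \<in> U i" for x i unfolding X_def using that by (intro span_base) blast
  have raise: "A x - \<theta> (Suc i) *s x \<in> U (Suc i)" if x: "x \<in> U i" for x i
  proof -
    have V: "x \<in> V" "A x \<in> V" "\<theta> (Suc i) *s x \<in> V"
      using UV[OF x] D(1,2) by (auto intro: endo_closed subspace_scale)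
    have "E' j (A x - \<theta> (Suc i) *s x) = 0" if "j \<le> d" "Suc i < j" for j
    proof -
      have "E' j (A x) = 0"
        using x that by (intro tridiagonal_action_eq_0[OF sr' D(2) tri']) (auto simp: U_def)
      then show ?thesis using that x V
        by (simp add: endo_diff[OF D(1) D'(4)] endo_scale[OF D'(4)] U_def)
    qed
    moreover have "E j (A x - \<theta> (Suc i) *s x) = 0" if "j \<le> d" "j \<le> Suc i" for j
    proof -
      have "E j (A x - \<theta> (Suc i) *s x) = (\<theta> j - \<theta> (Suc i)) *s E j x"
        using that V spectral_resolution_commute[OF sr]
        by (simp add: endo_diff[OF D(1) D(4)] endo_scale[OF D(4)] scale_left_diff_distrib)
      then show ?thesis using that x by (cases "j = Suc i") (auto simp: U_def)
    qed
    ultimately show ?thesis using V D(1) by (auto simp: U_def intro: subspace_diff)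
  qed
  have lower: "A' x - \<theta>' i *s x \<in> U (i - 1)" if x: "x \<in> U i" for x i
  proof -
    have V: "x \<in> V" "A' x \<in> V" "\<theta>' i *s x \<in> V"
      using UV[OF x] D'(1,2) by (auto intro: endo_closed subspace_scale)
    have *: "E' j (A' x - \<theta>' i *s x) = 0" if "j \<le> d" "i \<le> j" for j
    proof -
      have "E' j (A' x - \<theta>' i *s x) = (\<theta>' j - \<theta>' i) *s E' j x"
        using that V spectral_resolution_commute[OF sr']
        by (simp add: endo_diff[OF D(1) D'(4)] endo_scale[OF D'(4)] scale_left_diff_distrib)
      then show ?thesis using that x by (cases "j = i") (auto simp: U_def)
    qed
    show ?thesis
    proof (cases "i = 0")
      case True
      have "A' x - \<theta>' i *s x = (\<Sum>j\<le>d. E' j (A' x - \<theta>' i *s x))"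
        using V D(1) D'(6) by (simp add: subspace_diff)
      also have "\<dots> = 0" using * True by (intro sum.neutral) auto
      \<comment> \<open>the target \<open>U (i - 1)\<close> is \<open>U 0\<close> here, and contains the zero vector\<close>
      finally show ?thesis
        using D(1) endo_0[OF D(1) D(4)] endo_0[OF D(1) D'(4)] by (auto simp: U_def subspace_0)
    next
      case False
      have "E j (A' x - \<theta>' i *s x) = 0" if "j \<le> d" "j \<le> i - 1" for j
      proof -
        have "E j (A' x) = 0"
          using x that False by (intro tridiagonal_action_eq_0[OF sr D'(2) tri]) (auto simp: U_def)
        then show ?thesis using that x V
          by (simp add: endo_diff[OF D(1) D(4)] endo_scale[OF D(4)] U_def)
      qed
      then show ?thesis using * V D(1) False by (auto simp: U_def intro: subspace_diff)
    qed
  qed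
  have inX: "C ` X \<subseteq> X" if C: "endo V C" and step: "\<And>x i. x \<in> U i \<Longrightarrow> \<exists>c j. C x - c *s x \<in> U j" for C
  proof -
    have "C x \<in> X" if x: "x \<in> U i" for x i
    proof -
      obtain c j where "C x - c *s x \<in> U j" using step[OF x] by blast
      then have "(C x - c *s x) + c *s x \<in> X"
        unfolding X_def using UX x by (intro span_add span_scale) (auto simp: X_def)
      then show ?thesis by simp
    qed
    then show ?thesis unfolding X_def
      using UV by (intro endo_image_span_subset[OF D(1) C]) (auto simp: X_def)
  qed
  have "X \<subseteq> V" unfolding X_def using UV D(1) by (intro span_minimal) auto
  moreover have "A ` X \<subseteq> X" using inX[OF D(2)] raise by blast
  moreover have "A' ` X \<subseteq> X" using inX[OF D'(2)] lower by blast
  moreover have "subspace X" unfolding X_def by simp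
  ultimately have dich: "X = {0} \<or> X = V" using irr by (simp add: irreducible_on_def)
  obtain v where v: "v \<in> V" "E d v \<noteq> 0" using nzd by auto
  have Edv: "E d v \<in> V" using spectral_resolution_mem[OF sr _ v(1)] by simp
  have "E' j (E d v) = 0" if "j \<le> d" "d - 1 < j" for j
    using E'd[OF Edv] that d by (cases "j = d") auto
  moreover have "E j (E d v) = 0" if "j \<le> d" "j \<le> d - 1" for j
    using spectral_resolution_orthogonal[OF sr v(1), of d j] that d by auto
  ultimately have "E d v \<in> U (d - 1)" using Edv by (simp add: U_def)
  then have "E d v \<in> X" by (rule UX)
  then have "X = V" using dich v(2) by auto
  moreover have "X \<subseteq> {v \<in> V. E 0 v = 0}"
    unfolding X_def using subspace_kernel[OF D(1) D(4)] by (intro span_minimal) (auto simp: U_def)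
  ultimately have "E 0 v = 0" if "v \<in> V" for v using that by blast
  then show False using nz0 by blast
qed

text \<open>
  A zero idempotent forces the last one of its list to be zero, so only the last ones matter.  For
  \<open>E d\<close> this is an assumption, for \<open>E' d\<close> it is the previous lemma.
\<close>

lemma irreducible_idempotents_nonzero:
  assumes sr: "spectral_resolution V d A \<theta> E" and sr': "spectral_resolution V d A' \<theta>' E'"
    and tri: "tridiagonal_action V d E A'" and tri': "tridiagonal_action V d E' A"
    and irr: "irreducible_on V A A'"
    and nz: "\<exists>v\<in>V. E 0 v \<noteq> 0" "\<exists>v\<in>V. E d v \<noteq> 0" "\<exists>v\<in>V. E' 0 v \<noteq> 0"
  shows "\<forall>i\<le>d. \<exists>v\<in>V. E i v \<noteq> 0" and "\<forall>i\<le>d. \<exists>v\<in>V. E' i v \<noteq> 0"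
proof -
  note D = spectral_resolutionD[OF sr] and D' = spectral_resolutionD[OF sr']
  have irr': "irreducible_on V A' A" using irr by (auto simp: irreducible_on_def)
  show "\<forall>i\<le>d. \<exists>v\<in>V. E i v \<noteq> 0"
  proof (intro allI impI, rule ccontr)
    fix i assume "i \<le> d" "\<not> (\<exists>v\<in>V. E i v \<noteq> 0)"
    then have "E d v = 0" if "v \<in> V" for v
      using nz(1) that idempotents_vanish_beyond_gap[OF sr D'(2) tri irr, of _ i v d] by blast
    then show False using nz(2) by blast
  qed
  have nz': "\<exists>v\<in>V. E' d v \<noteq> 0"
    using nz dual_last_idempotent_nonzero[OF sr sr' tri tri' irr] by (cases "d = 0") auto
  show "\<forall>i\<le>d. \<exists>v\<in>V. E' i v \<noteq> 0"
  proof (intro allI impI, rule ccontr)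
    fix i assume "i \<le> d" "\<not> (\<exists>v\<in>V. E' i v \<noteq> 0)"
    then have "E' d v = 0" if "v \<in> V" for v
      using nz(3) that idempotents_vanish_beyond_gap[OF sr' D(2) tri' irr', of _ i v d] by blast
    then show False using nz' by blast
  qed
qed

section \<open>The polynomials in the split sequence\<close>

lemma tau_cong: "(\<And>j. j < i \<Longrightarrow> \<theta> j = \<mu> j) \<Longrightarrow> tau A \<theta> i = tau A \<mu> i"
  by (induction i) auto

lemma endo_tau:
  assumes "subspace V" "endo V A"
  shows "endo V (tau A \<theta> i)"
proof (induction i)
  case (Suc i)
  then show ?case
    using assms
    by (simp add: endo_def subspace_diff subspace_scale scale_right_distrib scale_right_diff_distrib mult.commute)
qed (simp add: endo_def)

lemma tau_invariant:
  assumes "subspace X" "A ` X \<subseteq> X" "x \<in> X"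
  shows "tau A \<theta> i x \<in> X"
  using assms by (induction i) (auto intro!: subspace_diff subspace_scale)

end

section \<open>The quotient of a sharp mock tridiagonal system\<close>

text \<open>
  Sequences are indexed by words in two letters, through their codes.  On the sequence of all
  values \<open>f (w x)\<close> of a function at words \<open>w\<close>, replacing \<open>x\<close> by its image under the letter \<open>b\<close> amounts
  to replacing each \<open>w\<close> by the word that applies \<open>b\<close> first and then \<open>w\<close>.
\<close>

definition shift :: "bool \<Rightarrow> (nat \<Rightarrow> 'f) \<Rightarrow> nat \<Rightarrow> 'f" where
  "shift b f = (\<lambda>n. f (to_nat (b # from_nat n)))"

interpretation sq: vector_space seq_scale
  by (rule vector_space_seq_scale)

lemma shift_linear:
  "shift b (f + g) = shift b f + shift b g" "shift b (seq_scale c f) = seq_scale c (shift b f)"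
  by (simp_all add: shift_def fun_eq_iff seq_scale_def)

locale sharp_mtd_system = vector_space scale
  for scale :: "'f::field \<Rightarrow> 'v::ab_group_add \<Rightarrow> 'v" (infixr "*s" 75) +
  fixes V :: "'v set" and d :: nat and A A' :: "'v \<Rightarrow> 'v" and E E' :: "nat \<Rightarrow> 'v \<Rightarrow> 'v" and v0 :: 'v
  assumes mtd: "mtd_system V d A E A' E'"
    and v0_nonzero: "v0 \<noteq> 0" and line: "E' 0 ` V = span {v0}"
begin

abbreviation "\<theta> \<equiv> eigenvalue_seq V A E"
abbreviation "\<theta>' \<equiv> eigenvalue_seq V A' E'"

lemma subspace_V: "subspace V"
  using mtd by (simp add: mtd_system_def pre_td_system_def fin_pos_dim_def)

lemma resolution: "spectral_resolution V d A \<theta> E"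
  and resolution': "spectral_resolution V d A' \<theta>' E'"
  using mtd subspace_V by (auto simp: mtd_system_def pre_td_system_def intro: spectral_resolution_of_ordering)

lemma tridiagonal: "tridiagonal_action V d E A'" "tridiagonal_action V d E' A"
  using mtd by (auto simp: mtd_system_def pre_td_system_def)

lemma endo_E'0: "endo V (E' 0)"
  using spectral_resolutionD(4)[OF resolution'] by simp

lemma v0_mem: "v0 \<in> V" and E'0_v0: "E' 0 v0 = v0"
proof -
  have "v0 \<in> E' 0 ` V" unfolding line by (simp add: span_base)
  then obtain u where u: "u \<in> V" "v0 = E' 0 u" by auto
  then show "v0 \<in> V" using endo_closed[OF endo_E'0] by simp
  show "E' 0 v0 = v0" using u spectral_resolution_orthogonal[OF resolution', of u 0 0] by simp
qed

definition coord :: "'v \<Rightarrow> 'f" where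
  "coord x = (SOME c. E' 0 x = c *s v0)"

lemma coord: "x \<in> V \<Longrightarrow> E' 0 x = coord x *s v0"
proof -
  assume "x \<in> V"
  then have "E' 0 x \<in> span {v0}" using line by blast
  then have "\<exists>c. E' 0 x = c *s v0" by (auto simp: span_singleton)
  then show ?thesis unfolding coord_def by (rule someI_ex)
qed

lemma coord_eqI: "x \<in> V \<Longrightarrow> E' 0 x = c *s v0 \<Longrightarrow> coord x = c"
  using coord v0_nonzero by simp

lemma coord_add: "x \<in> V \<Longrightarrow> y \<in> V \<Longrightarrow> coord (x + y) = coord x + coord y"
  using subspace_V endo_E'0 by (intro coord_eqI) (simp_all add: subspace_add endo_add coord scale_left_distrib)

lemma coord_scale: "x \<in> V \<Longrightarrow> coord (c *s x) = c * coord x"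
  using subspace_V endo_E'0 by (intro coord_eqI) (simp_all add: subspace_scale endo_scale coord)

lemma coord_v0: "coord v0 = 1"
  using v0_mem E'0_v0 by (intro coord_eqI) simp_all

text \<open>
  The letter \<open>True\<close> stands for \<open>A\<close> and \<open>False\<close> for \<open>A'\<close>.  The head of a word acts first.
\<close>

definition letter :: "bool \<Rightarrow> 'v \<Rightarrow> 'v" where
  "letter b = (if b then A else A')"

definition word :: "bool list \<Rightarrow> 'v \<Rightarrow> 'v" where
  "word bs = fold letter bs"

definition invariant :: "'v set \<Rightarrow> bool" where
  "invariant X \<longleftrightarrow> subspace X \<and> X \<subseteq> V \<and> (\<forall>b. letter b ` X \<subseteq> X)"

lemma invariantD:
  assumes "invariant X"
  shows "subspace X" "x \<in> X \<Longrightarrow> x \<in> V" "x \<in> X \<Longrightarrow> letter b x \<in> X"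
  using assms by (auto simp: invariant_def)

lemma endo_letter: "endo V (letter b)"
  using spectral_resolutionD(2)[OF resolution] spectral_resolutionD(2)[OF resolution']
  by (simp add: letter_def)

lemma invariant_V: "invariant V"
  using subspace_V endo_letter by (auto simp: invariant_def intro: endo_closed)

lemma word_mem: "invariant X \<Longrightarrow> x \<in> X \<Longrightarrow> word bs x \<in> X"
  unfolding word_def by (induction bs arbitrary: x) (simp_all add: invariantD(3)[of X])

lemma word_add: "x \<in> V \<Longrightarrow> y \<in> V \<Longrightarrow> word bs (x + y) = word bs x + word bs y"
  unfolding word_def
  by (induction bs arbitrary: x y) (simp_all add: endo_add[OF endo_letter] endo_closed[OF endo_letter])

lemma word_scale: "x \<in> V \<Longrightarrow> word bs (c *s x) = c *s word bs x"
  unfolding word_def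
  by (induction bs arbitrary: x) (simp_all add: endo_scale[OF endo_letter] endo_closed[OF endo_letter])

lemma invariant_idempotents:
  assumes "invariant X" "x \<in> X" "i \<le> d"
  shows "E i x \<in> X" "E' i x \<in> X"
proof -
  have X: "subspace X" "X \<subseteq> V" and "letter True ` X \<subseteq> X" "letter False ` X \<subseteq> X"
    using assms(1) by (auto simp: invariant_def)
  then have "A ` X \<subseteq> X" "A' ` X \<subseteq> X" by (simp_all add: letter_def)
  then show "E i x \<in> X" "E' i x \<in> X"
    using spectral_resolution_invariant[OF resolution X _ assms(2,3)]
      spectral_resolution_invariant[OF resolution' X _ assms(2,3)] by simp_all
qed

text \<open>
  The quotient map.  Its kernel consists of the vectors that no word takes to a vector with nonzero
  projection to the line of \<open>v0\<close>, and so is the largest invariant subspace on which \<open>E' 0\<close> vanishes.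
\<close>

definition moments :: "'v \<Rightarrow> nat \<Rightarrow> 'f" where
  "moments x = (\<lambda>n. coord (word (from_nat n) x))"

lemma moments_add: "x \<in> V \<Longrightarrow> y \<in> V \<Longrightarrow> moments (x + y) = moments x + moments y"
  by (simp add: moments_def fun_eq_iff word_add coord_add word_mem[OF invariant_V])

lemma moments_scale: "x \<in> V \<Longrightarrow> moments (c *s x) = seq_scale c (moments x)"
  by (simp add: moments_def fun_eq_iff word_scale coord_scale seq_scale_def word_mem[OF invariant_V])

lemma moments_0: "moments 0 = 0"
  using moments_scale[of 0 0] subspace_0[OF subspace_V] by simp

lemma moments_diff: "x \<in> V \<Longrightarrow> y \<in> V \<Longrightarrow> moments (x - y) = moments x - moments y"
  using moments_add[of "x - y" y] subspace_diff[OF subspace_V, of x y] by (simp add: algebra_simps)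

lemma moments_sum:
  assumes "\<And>i. i \<in> S \<Longrightarrow> u i \<in> V"
  shows "moments (\<Sum>i\<in>S. u i) = (\<Sum>i\<in>S. moments (u i))"
  using assms
proof (induction S rule: infinite_finite_induct)
  case (insert i S)
  then show ?case
    using moments_add[of "u i" "sum u S"] subspace_sum[OF subspace_V, of S u] by simp
qed (simp_all add: moments_0)

lemma moments_letter: "moments (letter b x) = shift b (moments x)"
  by (simp add: moments_def shift_def word_def)

lemma moments_at_empty_word: "moments x (to_nat ([] :: bool list)) = coord x"
  by (simp add: moments_def word_def)

lemma moments_nonzero: "coord x \<noteq> 0 \<Longrightarrow> moments x \<noteq> 0"
  using moments_at_empty_word[of x] by auto

lemma moments_vanish:
  assumes "invariant X" "\<And>x. x \<in> X \<Longrightarrow> coord x = 0" "x \<in> X"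
  shows "moments x = 0"
  using assms word_mem by (simp add: moments_def fun_eq_iff)

lemma subspace_moments_preimage:
  assumes X: "subspace X" "X \<subseteq> V" and Y: "sq.subspace Y"
  shows "subspace {x \<in> X. moments x \<in> Y}"
proof (rule subspaceI)
  show "0 \<in> {x \<in> X. moments x \<in> Y}"
    using subspace_0[OF X(1)] sq.subspace_0[OF Y] by (simp add: moments_0)
next
  fix x y assume "x \<in> {x \<in> X. moments x \<in> Y}" "y \<in> {x \<in> X. moments x \<in> Y}"
  then show "x + y \<in> {x \<in> X. moments x \<in> Y}"
    using subspace_add[OF X(1), of x y] sq.subspace_add[OF Y, of "moments x" "moments y"]
      moments_add[OF subsetD[OF X(2)] subsetD[OF X(2)], of x y] by simp
next
  fix c x assume "x \<in> {x \<in> X. moments x \<in> Y}"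
  then show "c *s x \<in> {x \<in> X. moments x \<in> Y}"
    using subspace_scale[OF X(1), of x c] sq.subspace_scale[OF Y, of "moments x" c]
      moments_scale[OF subsetD[OF X(2)], of x c] by simp
qed

lemma invariant_moments_preimage:
  assumes "invariant X" "sq.subspace Y" "\<And>b. shift b ` Y \<subseteq> Y"
  shows "invariant {x \<in> X. moments x \<in> Y}"
  unfolding invariant_def
proof (intro conjI allI)
  note X = invariantD[OF assms(1)]
  show "subspace {x \<in> X. moments x \<in> Y}" by (rule subspace_moments_preimage) (use X(1,2) assms(2) in auto)
  show "{x \<in> X. moments x \<in> Y} \<subseteq> V" using X(2) by blast
  show "letter b ` {x \<in> X. moments x \<in> Y} \<subseteq> {x \<in> X. moments x \<in> Y}" for b
  proof safe
    fix x assume "x \<in> X" "moments x \<in> Y"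
    then show "letter b x \<in> X" "moments (letter b x) \<in> Y"
      using X(3) assms(3)[of b] unfolding moments_letter by blast+
  qed
qed

definition cyclic :: "'v set" where
  "cyclic = \<Inter> {X. invariant X \<and> v0 \<in> X}"

lemma invariant_cyclic: "invariant cyclic"
  unfolding invariant_def
proof (intro conjI allI)
  show "subspace cyclic" unfolding cyclic_def by (rule subspace_Inter) (auto simp: invariant_def)
  show "cyclic \<subseteq> V" unfolding cyclic_def using invariant_V v0_mem by blast
  show "letter b ` cyclic \<subseteq> cyclic" for b unfolding cyclic_def using invariantD(3) by blast
qed

lemmas cyclic_subspace = invariantD(1)[OF invariant_cyclic]
  and cyclic_in_V = invariantD(2)[OF invariant_cyclic]
  and cyclic_letter = invariantD(3)[OF invariant_cyclic]

lemma v0_cyclic: "v0 \<in> cyclic"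
  by (auto simp: cyclic_def)

lemma cyclic_least: "invariant X \<Longrightarrow> v0 \<in> X \<Longrightarrow> cyclic \<subseteq> X"
  by (auto simp: cyclic_def)

text \<open>
  The quotient of the cyclic module generated by \<open>v0\<close>.
\<close>

definition Q :: "(nat \<Rightarrow> 'f) set" where
  "Q = moments ` cyclic"

text \<open>
  The map that \<open>C\<close> induces on \<open>Q\<close>, by means of an arbitrary choice of representatives; the choice
  is immaterial when \<open>C\<close> preserves the kernel of \<open>moments\<close>.
\<close>

definition induced :: "('v \<Rightarrow> 'v) \<Rightarrow> (nat \<Rightarrow> 'f) \<Rightarrow> nat \<Rightarrow> 'f" where
  "induced C f = moments (C (inv_into cyclic moments f))"

abbreviation "F i \<equiv> induced (E i)"
abbreviation "F' i \<equiv> induced (E' i)"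

lemma induced_moments:
  assumes C: "endo V C" and inv: "\<And>X x. invariant X \<Longrightarrow> x \<in> X \<Longrightarrow> C x \<in> X" and w: "w \<in> cyclic"
  shows "induced C (moments w) = moments (C w)"
proof -
  define u where "u = inv_into cyclic moments (moments w)"
  have u: "u \<in> cyclic" "moments u = moments w"
    using w by (simp_all add: u_def inv_into_into f_inv_into_f)
  note V = cyclic_in_V[OF u(1)] cyclic_in_V[OF w]
  have ker: "invariant {x \<in> V. moments x \<in> {0}}"
    by (rule invariant_moments_preimage[OF invariant_V sq.subspace_single_0])
      (simp add: shift_def zero_fun_def)
  have "u - w \<in> {x \<in> V. moments x \<in> {0}}"
    using u V by (simp add: moments_diff subspace_diff[OF subspace_V])
  from inv[OF ker this] have "moments (C (u - w)) = 0" by simp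
  then have "moments (C u) = moments (C w)"
    using V by (simp add: endo_diff[OF subspace_V C] moments_diff endo_closed[OF C])
  then show ?thesis by (simp add: induced_def u_def)
qed

lemma F_moments: "i \<le> d \<Longrightarrow> w \<in> cyclic \<Longrightarrow> F i (moments w) = moments (E i w)"
  by (rule induced_moments)
    (simp_all add: invariant_idempotents spectral_resolutionD(4)[OF resolution])

lemma F'_moments: "i \<le> d \<Longrightarrow> w \<in> cyclic \<Longrightarrow> F' i (moments w) = moments (E' i w)"
  by (rule induced_moments)
    (simp_all add: invariant_idempotents spectral_resolutionD(4)[OF resolution'])

lemma subspace_Q: "sq.subspace Q"
  unfolding Q_def sq.subspace_def
proof (intro conjI ballI allI)
  show "0 \<in> moments ` cyclic" using moments_0 subspace_0[OF cyclic_subspace] by (metis imageI)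
next
  fix f g assume "f \<in> moments ` cyclic" "g \<in> moments ` cyclic"
  then obtain x y where "f = moments x" "x \<in> cyclic" "g = moments y" "y \<in> cyclic" by auto
  then show "f + g \<in> moments ` cyclic"
    using moments_add[of x y] cyclic_in_V subspace_add[OF cyclic_subspace, of x y] by (metis imageI)
next
  fix c f assume "f \<in> moments ` cyclic"
  then obtain x where "f = moments x" "x \<in> cyclic" by auto
  then show "seq_scale c f \<in> moments ` cyclic"
    using moments_scale[of x c] cyclic_in_V subspace_scale[OF cyclic_subspace, of x c] by (metis imageI)
qed

lemma endo_Q_shift: "sq.endo Q (shift b)"
  unfolding sq.endo_def using cyclic_letter
  by (auto simp: shift_linear Q_def moments_letter[symmetric])

text \<open>
  One lemma for both \<open>A\<close> and \<open>A'\<close>, according to the letter \<open>b\<close>.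
\<close>

lemma spectral_resolution_Q:
  assumes sr: "spectral_resolution V d (letter b) \<mu> P"
    and mem: "\<And>i w. i \<le> d \<Longrightarrow> w \<in> cyclic \<Longrightarrow> P i w \<in> cyclic"
    and ind: "\<And>i w. i \<le> d \<Longrightarrow> w \<in> cyclic \<Longrightarrow> induced (P i) (moments w) = moments (P i w)"
  shows "sq.spectral_resolution Q d (shift b) \<mu> (\<lambda>i. induced (P i))"
  unfolding sq.spectral_resolution_def
proof (intro conjI allI impI ballI)
  note D = spectral_resolutionD[OF sr]
  show "sq.subspace Q" "sq.endo Q (shift b)" by (rule subspace_Q endo_Q_shift)+
  show "inj_on \<mu> {..d}" by (rule D(3))
  fix i assume i: "i \<le> d"
  have add: "induced (P i) (moments x + moments y) = moments (P i x) + moments (P i y)"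
    if "x \<in> cyclic" "y \<in> cyclic" for x y
    using ind[OF i subspace_add[OF cyclic_subspace that]] that[THEN cyclic_in_V] D(4)[OF i]
    by (simp add: moments_add endo_add endo_closed)
  have scale: "induced (P i) (seq_scale c (moments x)) = seq_scale c (moments (P i x))"
    if "x \<in> cyclic" for x c
    using ind[OF i subspace_scale[OF cyclic_subspace that]] that[THEN cyclic_in_V] D(4)[OF i]
    by (simp add: moments_scale endo_scale endo_closed)
  show "sq.endo Q (induced (P i))"
    unfolding sq.endo_def Q_def using i mem by (auto simp: ind add scale)
next
  note D = spectral_resolutionD[OF sr]
  fix i f assume i: "i \<le> d" and "f \<in> Q"
  then obtain w where w: "w \<in> cyclic" "f = moments w" by (auto simp: Q_def)
  then have "shift b (induced (P i) f) = moments (letter b (P i w))"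
    using i by (simp add: ind moments_letter)
  also have "\<dots> = seq_scale (\<mu> i) (induced (P i) f)"
    using i w D(5)[OF i cyclic_in_V[OF w(1)]] cyclic_in_V[OF mem[OF i w(1)]]
    by (simp add: ind moments_scale)
  finally show "shift b (induced (P i) f) = seq_scale (\<mu> i) (induced (P i) f)" .
next
  note D = spectral_resolutionD[OF sr]
  fix f assume "f \<in> Q"
  then obtain w where w: "w \<in> cyclic" "f = moments w" by (auto simp: Q_def)
  have "(\<Sum>i\<le>d. induced (P i) f) = (\<Sum>i\<le>d. moments (P i w))" using w by (simp add: ind)
  also have "\<dots> = moments (\<Sum>i\<le>d. P i w)"
    using mem w cyclic_in_V by (subst moments_sum) auto
  also have "\<dots> = f" using D(6) w cyclic_in_V by simp
  finally show "(\<Sum>i\<le>d. induced (P i) f) = f" .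
qed

lemma resolution_Q: "sq.spectral_resolution Q d (shift True) \<theta> F"
  using resolution
  by (intro spectral_resolution_Q)
    (simp_all add: letter_def F_moments invariant_idempotents(1)[OF invariant_cyclic])

lemma resolution'_Q: "sq.spectral_resolution Q d (shift False) \<theta>' F'"
  using resolution'
  by (intro spectral_resolution_Q)
    (simp_all add: letter_def F'_moments invariant_idempotents(2)[OF invariant_cyclic])

lemma tridiagonal_Q: "sq.tridiagonal_action Q d F (shift False)" "sq.tridiagonal_action Q d F' (shift True)"
proof -
  have "F i (shift False (F j (moments w))) = moments (E i (letter False (E j w)))"
    "F' i (shift True (F' j (moments w))) = moments (E' i (letter True (E' j w)))"
    if "i \<le> d" "j \<le> d" "w \<in> cyclic" for i j w
    using that invariant_idempotents[OF invariant_cyclic]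
    by (simp_all add: F_moments F'_moments moments_letter[symmetric] cyclic_letter)
  then show "sq.tridiagonal_action Q d F (shift False)" "sq.tridiagonal_action Q d F' (shift True)"
    using tridiagonal cyclic_in_V
    by (auto simp: sq.tridiagonal_action_def tridiagonal_action_def Q_def letter_def moments_0)
qed

text \<open>
  The preimage \<open>X\<close> of an invariant \<open>Y\<close> is stable under \<open>E' 0\<close>.  Either it contains a nonzero
  multiple of \<open>v0\<close>, hence the whole cyclic module, or \<open>E' 0\<close> vanishes on it and \<open>X\<close> lies in
  the kernel of \<open>moments\<close>.
\<close>

lemma irreducible_Q: "sq.irreducible_on Q (shift True) (shift False)"
  unfolding sq.irreducible_on_def
proof (intro allI impI)
  fix Y :: "(nat \<Rightarrow> 'f) set"
  assume Y: "sq.subspace Y \<and> Y \<subseteq> Q \<and> shift True ` Y \<subseteq> Y \<and> shift False ` Y \<subseteq> Y"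
  have "shift b ` Y \<subseteq> Y" for b using Y by (cases b) auto
  define X where "X = {x \<in> cyclic. moments x \<in> Y}"
  have X: "invariant X"
    unfolding X_def using Y \<open>\<And>b. shift b ` Y \<subseteq> Y\<close>
    by (intro invariant_moments_preimage invariant_cyclic) auto
  have YX: "Y = moments ` X" using Y by (auto simp: X_def Q_def)
  show "Y = {0} \<or> Y = Q"
  proof (cases "\<exists>x\<in>X. coord x \<noteq> 0")
    case True
    then obtain x where x: "x \<in> X" "coord x \<noteq> 0" by auto
    have "E' 0 x \<in> X" using invariant_idempotents(2)[OF X x(1)] by simp
    then have "inverse (coord x) *s (coord x *s v0) \<in> X"
      using coord invariantD[OF X] x(1) by (metis subspace_scale)
    then have "v0 \<in> X" using x(2) by simp
    then have "cyclic \<subseteq> X" by (rule cyclic_least[OF X])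
    then have "X = cyclic" by (auto simp: X_def)
    then show ?thesis using YX by (simp add: Q_def)
  next
    case False
    then have "moments x = 0" if "x \<in> X" for x using moments_vanish[OF X _ that] by blast
    then have "Y \<subseteq> {0}" using YX by auto
    then show ?thesis using Y sq.subspace_0 by blast
  qed
qed

lemma moments_v0_Q: "moments v0 \<in> Q"
  using v0_cyclic by (simp add: Q_def)

lemma moments_v0_nonzero: "moments v0 \<noteq> 0"
  using coord_v0 by (simp add: moments_nonzero)

lemma F'0_Q: "w \<in> cyclic \<Longrightarrow> F' 0 (moments w) = seq_scale (coord w) (moments v0)"
  using cyclic_in_V by (simp add: F'_moments coord moments_scale v0_mem)

text \<open>
  For \<open>i = 0\<close> and \<open>i = d\<close> the second hypothesis is part of the definition of a mock tridiagonal
  system.  It says that \<open>E i v0\<close> has a nonzero projection to the line of \<open>v0\<close>, which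
  keeps it out of the kernel of \<open>moments\<close>.
\<close>

lemma F_nonzero:
  assumes "i \<le> d" "\<exists>v\<in>V. E' 0 (E i (E' 0 v)) \<noteq> 0"
  shows "\<exists>f\<in>Q. F i f \<noteq> 0"
proof -
  obtain v where v: "v \<in> V" "E' 0 (E i (E' 0 v)) \<noteq> 0" using assms by auto
  have Ei: "endo V (E i)" using spectral_resolutionD(4)[OF resolution assms(1)] .
  have "E' 0 (E i (E' 0 v)) = coord v *s E' 0 (E i v0)"
    using v(1) v0_mem by (simp add: coord endo_scale[OF Ei] endo_scale[OF endo_E'0] endo_closed[OF Ei]
        del: scale_scale)
  then have "E' 0 (E i v0) \<noteq> 0" using v by auto
  then have "coord (E i v0) \<noteq> 0" using v0_mem endo_closed[OF Ei] by (auto simp: coord)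
  then have "F i (moments v0) \<noteq> 0"
    using F_moments[OF assms(1) v0_cyclic] moments_nonzero by simp
  then show ?thesis using moments_v0_Q by blast
qed

lemma idempotents_nonzero_Q: "\<forall>i\<le>d. \<exists>f\<in>Q. F i f \<noteq> 0" "\<forall>i\<le>d. \<exists>f\<in>Q. F' i f \<noteq> 0"
proof -
  have "\<exists>f\<in>Q. F 0 f \<noteq> 0" "\<exists>f\<in>Q. F d f \<noteq> 0"
    using mtd F_nonzero[of 0] F_nonzero[of d] by (simp_all add: mtd_system_def)
  moreover have "\<exists>f\<in>Q. F' 0 f \<noteq> 0"
    using F'0_Q[OF v0_cyclic] coord_v0 moments_v0_nonzero moments_v0_Q by (intro bexI[of _ "moments v0"]) auto
  ultimately show "\<forall>i\<le>d. \<exists>f\<in>Q. F i f \<noteq> 0" "\<forall>i\<le>d. \<exists>f\<in>Q. F' i f \<noteq> 0"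
    using sq.irreducible_idempotents_nonzero[OF resolution_Q resolution'_Q tridiagonal_Q irreducible_Q]
    by blast+
qed

text \<open>
  A basis of the cyclic module is mapped to a generating set of \<open>Q\<close>.
\<close>

lemma fin_pos_dim_Q: "sq.fin_pos_dim Q"
proof -
  obtain B where B: "finite B" "span B = V"
    using mtd by (auto simp: mtd_system_def pre_td_system_def fin_pos_dim_def)
  obtain G where G: "G \<subseteq> cyclic" "independent G" "cyclic \<subseteq> span G"
    by (rule basis_exists[of cyclic])
  have "G \<subseteq> span B" unfolding B(2) using G(1) cyclic_in_V by blast
  then have fin: "finite G" using independent_span_bound[OF B(1) G(2)] by simp
  have "span G \<subseteq> {x \<in> V. moments x \<in> sq.span (moments ` G)}"
  proof (rule span_minimal)
    show "G \<subseteq> {x \<in> V. moments x \<in> sq.span (moments ` G)}"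
      using G(1) cyclic_in_V sq.span_superset[of "moments ` G"] by blast
    show "subspace {x \<in> V. moments x \<in> sq.span (moments ` G)}"
      by (intro subspace_moments_preimage subspace_V sq.subspace_span order_refl)
  qed
  then have "Q \<subseteq> sq.span (moments ` G)" using G(3) unfolding Q_def by blast
  moreover have "sq.span (moments ` G) \<subseteq> Q"
    using G(1) unfolding Q_def[symmetric]
    by (intro sq.span_minimal subspace_Q) (simp add: Q_def image_mono)
  ultimately have spQ: "sq.span (moments ` G) = Q" by blast
  obtain H where H: "H \<subseteq> Q" "sq.independent H" "Q \<subseteq> sq.span H" "card H = sq.dim Q"
    by (rule sq.basis_exists[of Q])
  have "finite H" using sq.independent_span_bound[OF finite_imageI[OF fin] H(2)] H(1) spQ by blast
  moreover have "H \<noteq> {}" using subsetD[OF H(3) moments_v0_Q] moments_v0_nonzero by auto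
  ultimately have "sq.dim Q > 0" using H(4) by (metis card_gt_0_iff)
  moreover have "\<exists>B. finite B \<and> sq.span B = Q"
    using finite_imageI[OF fin] spQ by (intro exI[of _ "moments ` G"] conjI)
  ultimately show ?thesis using subspace_Q by (simp add: sq.fin_pos_dim_def)
qed

lemma td_system_Q: "sq.td_system Q d d (shift True) F (shift False) F'"
proof -
  note FQ = sq.ordering_of_spectral_resolution[OF resolution_Q idempotents_nonzero_Q(1)]
  note F'Q = sq.ordering_of_spectral_resolution[OF resolution'_Q idempotents_nonzero_Q(2)]
  show ?thesis
    unfolding sq.td_system_def sq.pre_td_system_def
    using FQ F'Q fin_pos_dim_Q tridiagonal_Q irreducible_Q by (auto simp: sq.irreducible_on_def)
qed

lemma sharp_Q: "sq.sharp Q F'"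
proof -
  have "F' 0 ` Q = sq.span {moments v0}"
  proof safe
    fix f assume "f \<in> Q"
    then show "F' 0 f \<in> sq.span {moments v0}" using F'0_Q by (auto simp: Q_def sq.span_singleton)
  next
    fix g assume "g \<in> sq.span {moments v0}"
    then obtain c where g: "g = seq_scale c (moments v0)" by (auto simp: sq.span_singleton)
    have "c *s v0 \<in> cyclic" by (rule subspace_scale[OF cyclic_subspace v0_cyclic])
    moreover from this have "F' 0 (moments (c *s v0)) = g"
      using F'0_Q g by (simp add: coord_scale v0_mem coord_v0)
    ultimately show "g \<in> F' 0 ` Q" by (auto simp: Q_def)
  qed
  then show ?thesis using sq.dim_line[OF moments_v0_nonzero] by (simp add: sq.sharp_def)
qed

lemma eigenvalue_seq_Q:
  assumes "i \<le> d"
  shows "sq.eigenvalue_seq Q (shift True) F i = \<theta> i" "sq.eigenvalue_seq Q (shift False) F' i = \<theta>' i"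
  using idempotents_nonzero_Q assms sq.eigenvalue_seq_spectral[OF resolution_Q assms]
    sq.eigenvalue_seq_spectral[OF resolution'_Q assms] by blast+

lemma moments_tau:
  assumes "w \<in> cyclic"
  shows "sq.tau (shift True) \<mu> i (moments w) = moments (tau A \<mu> i w)"
proof (induction i)
  case (Suc i)
  have "letter True ` cyclic \<subseteq> cyclic" using cyclic_letter by blast
  then have t: "tau A \<mu> i w \<in> cyclic" "A (tau A \<mu> i w) \<in> cyclic"
    using tau_invariant[OF cyclic_subspace _ assms, of A \<mu> i] cyclic_letter[of _ True]
    by (simp_all add: letter_def)
  have "moments (A (tau A \<mu> i w)) = shift True (moments (tau A \<mu> i w))"
    using moments_letter[of True] by (simp add: letter_def)
  then show ?case
    using t[THEN cyclic_in_V] Suc subspace_scale[OF subspace_V]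
    by (simp add: moments_diff moments_scale)
qed simp

text \<open>
  The conditions that characterise the split sequence of the given system and that of the
  quotient are both equivalent to the same condition on \<open>v0\<close>, for every candidate value \<open>c\<close>.  Thus
  the two definite descriptions coincide.
\<close>

lemma split_condition:
  "(\<forall>v\<in>V. E' 0 (tau A \<mu> i (E' 0 v)) = c *s E' 0 v) \<longleftrightarrow> coord (tau A \<mu> i v0) = c"
proof -
  have \<tau>: "endo V (tau A \<mu> i)"
    by (rule endo_tau[OF subspace_V spectral_resolutionD(2)[OF resolution]])
  have eq: "E' 0 (tau A \<mu> i (E' 0 v)) = coord v *s (coord (tau A \<mu> i v0) *s v0)" if "v \<in> V" for v
    using that v0_mem by (simp add: coord endo_scale[OF \<tau>] coord_scale endo_closed[OF \<tau>]
        endo_scale[OF endo_E'0])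
  show ?thesis
  proof
    assume "\<forall>v\<in>V. E' 0 (tau A \<mu> i (E' 0 v)) = c *s E' 0 v"
    then have "coord (tau A \<mu> i v0) *s v0 = c *s v0"
      using eq[OF v0_mem] v0_mem E'0_v0 coord_v0 by (metis scale_one)
    then show "coord (tau A \<mu> i v0) = c" using v0_nonzero by simp
  next
    assume "coord (tau A \<mu> i v0) = c"
    then show "\<forall>v\<in>V. E' 0 (tau A \<mu> i (E' 0 v)) = c *s E' 0 v"
      by (metis eq coord scale_left_commute)
  qed
qed

lemma split_condition_Q:
  "(\<forall>f\<in>Q. F' 0 (sq.tau (shift True) \<mu> i (F' 0 f)) = seq_scale c (F' 0 f)) \<longleftrightarrow> coord (tau A \<mu> i v0) = c"
proof -
  have \<tau>: "endo V (tau A \<mu> i)"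
    by (rule endo_tau[OF subspace_V spectral_resolutionD(2)[OF resolution]])
  have "letter True ` cyclic \<subseteq> cyclic" using cyclic_letter by blast
  then have t: "tau A \<mu> i w \<in> cyclic" if "w \<in> cyclic" for w
    using tau_invariant[OF cyclic_subspace _ that] by (simp add: letter_def)
  have eq: "F' 0 (sq.tau (shift True) \<mu> i (F' 0 (moments w))) =
      seq_scale (coord w * coord (tau A \<mu> i v0)) (moments v0)" if w: "w \<in> cyclic" for w
  proof -
    have "coord w *s v0 \<in> cyclic" by (rule subspace_scale[OF cyclic_subspace v0_cyclic])
    then have "F' 0 (sq.tau (shift True) \<mu> i (moments (coord w *s v0))) =
        seq_scale (coord w * coord (tau A \<mu> i v0)) (moments v0)"
      using F'0_Q[OF t[of "coord w *s v0"]] v0_mem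
      by (simp add: moments_tau endo_scale[OF \<tau>] coord_scale endo_closed[OF \<tau>])
    then show ?thesis using F'0_Q[OF w] v0_mem by (simp add: moments_scale)
  qed
  show ?thesis
  proof
    assume "\<forall>f\<in>Q. F' 0 (sq.tau (shift True) \<mu> i (F' 0 f)) = seq_scale c (F' 0 f)"
    then have "seq_scale (coord (tau A \<mu> i v0)) (moments v0) = seq_scale c (moments v0)"
      using eq[OF v0_cyclic] moments_v0_Q F'0_Q[OF v0_cyclic] coord_v0 by (metis mult_1 sq.scale_one)
    then show "coord (tau A \<mu> i v0) = c" using moments_v0_nonzero by simp
  next
    assume "coord (tau A \<mu> i v0) = c"
    then have "F' 0 (sq.tau (shift True) \<mu> i (F' 0 (moments w))) = seq_scale c (F' 0 (moments w))"
      if "w \<in> cyclic" for w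
      using eq[OF that] F'0_Q[OF that] by (metis sq.scale_scale mult.commute)
    then show "\<forall>f\<in>Q. F' 0 (sq.tau (shift True) \<mu> i (F' 0 f)) = seq_scale c (F' 0 f)"
      by (auto simp: Q_def)
  qed
qed

lemma split_seq_Q:
  assumes "i \<le> d"
  shows "sq.split_seq Q (shift True) F (shift False) F' i = split_seq V A E A' E' i"
proof -
  have \<tau>: "tau A (sq.eigenvalue_seq Q (shift True) F) i = tau A \<theta> i"
    using assms by (intro tau_cong) (simp add: eigenvalue_seq_Q)
  have "(\<Prod>j=1..i. sq.eigenvalue_seq Q (shift False) F' 0 - sq.eigenvalue_seq Q (shift False) F' j)
      = (\<Prod>j=1..i. \<theta>' 0 - \<theta>' j)"
    using assms by (intro prod.cong refl) (simp add: eigenvalue_seq_Q)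
  then show ?thesis
    unfolding sq.split_seq_def split_seq_def Let_def split_condition split_condition_Q \<tau> by simp
qed

lemma parameter_array_Q:
  "sq.parameter_array Q d d (shift True) F (shift False) F' = parameter_array V d d A E A' E'"
  unfolding sq.parameter_array_def parameter_array_def
  by (simp add: eigenvalue_seq_Q split_seq_Q)

end

theorem theorem2p7:
  fixes scale :: "'f::field \<Rightarrow> 'v::ab_group_add \<Rightarrow> 'v"
    and V :: "'v set" and d :: nat
    and A A' :: "'v \<Rightarrow> 'v" and E E' :: "nat \<Rightarrow> 'v \<Rightarrow> 'v"
  assumes "vector_space scale"
    and "vector_space.mtd_system scale V d A E A' E'"
    and "vector_space.sharp scale V E'"
  shows "\<exists>(W :: (nat \<Rightarrow> 'f) set) e \<delta> B F B' F'.
    vector_space.td_system seq_scale W e \<delta> B F B' F' \<and>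
    vector_space.sharp seq_scale W F' \<and>
    vector_space.parameter_array seq_scale W e \<delta> B F B' F' =
      vector_space.parameter_array scale V d d A E A' E'"
proof -
  interpret vs: vector_space scale by (rule assms(1))
  have V: "vs.subspace V" and A': "vs.diagonalizable V A'" "vs.primitive_idempotent_ordering V A' d E'"
    using assms(2) by (auto simp: vs.mtd_system_def vs.pre_td_system_def vs.fin_pos_dim_def)
  note sr' = vs.spectral_resolution_of_ordering(1)[OF V A']
  note D' = vs.spectral_resolutionD[OF sr']
  have sub: "vs.subspace (E' 0 ` V)"
    unfolding vs.spectral_resolution_image[OF sr' le0] vs.eigenspace_def vs.subspace_def
    using V D'(2) vs.endo_0[OF V D'(2)]
    by (auto simp: vs.subspace_0 vs.subspace_add vs.subspace_scale vs.endo_add vs.endo_scale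
        vs.scale_right_distrib mult.commute)
  obtain G where G: "G \<subseteq> E' 0 ` V" "vs.independent G" "E' 0 ` V \<subseteq> vs.span G" "card G = vs.dim (E' 0 ` V)"
    by (rule vs.basis_exists[of "E' 0 ` V"])
  then have "card G = 1" using assms(3) by (simp add: vs.sharp_def)
  then obtain v0 where v0: "G = {v0}" by (rule card_1_singletonE)
  have "v0 \<noteq> 0" using G(2) v0 vs.dependent_zero by blast
  moreover have "E' 0 ` V = vs.span {v0}"
    using G v0 vs.span_minimal[OF G(1) sub] by auto
  ultimately interpret sharp_mtd_system scale V d A A' E E' v0
    using assms(2) by unfold_locales
  show ?thesis
    using td_system_Q sharp_Q parameter_array_Q by blast
qed

end
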